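(* Let $\mathbb S$ be a real symmetric $4n\times4n$ matrix. The group $\mathcal N_{\mathbb S}$ is right-type if and only if $B^\beta_{lm}\in\mathrm{span}\{J^1,J^2,J^3,I_4\}$ for all $l,m\in\{0,\dots,n-1\}$ and $\beta\in\{1,2,3\}$.
   Context: Let $I^1,I^2,I^3$ be the $4\times4$ skew-symmetric matrices whose only nonzero entries above the diagonal are: $I^1_{12}=1,\ I^1_{34}=-1$; $I^2_{13}=1,\ I^2_{24}=1$; $I^3_{14}=1,\ I^3_{23}=-1$. Let $J^1,J^2,J^3$ be the $4\times4$ skew-symmetric matrices whose only nonzero entries above the diagonal are: $J^1_{12}=1,\ J^1_{34}=1$; $J^2_{13}=1,\ J^2_{24}=-1$; $J^3_{14}=1,\ J^3_{23}=1$. $I_4$ is the identity matrix; spans are real. Put $\mathbb I^\beta=\mathrm{diag}(I^\beta,\dots,I^\beta)$ ($4n\times4n$) and $B^\beta=\mathbb S\mathbb I^\beta+\mathbb I^\beta\mathbb S$. Write $\mathbb S=(\mathbb S^{(lm)})$ in $4\times4$ blocks, $l,m=0,\dots,n-1$; then $B^\beta=(B^\beta_{lm})$ with $B^\beta_{lm}=I^\beta\mathbb S^{(lm)}+\mathbb S^{(lm)}I^\beta$. $\mathcal N_{\mathbb S}$ is the step-two nilpotent Lie group $\mathbb R^{4n}\times\mathbb R^3$ with $(\mathbf x,\mathbf t)(\mathbf y,\mathbf s)=(\mathbf x+\mathbf y,\ t_\beta+s_\beta+2\sum_{a,b}B^\beta_{ab}x_ay_b)$, associated to the rigid quadratic hypersurface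 $\operatorname{Re}q_{n+1}=\phi(\mathbf q')$ in $\mathbb H^{n+1}$, where $\phi(\mathbf q')=\sum_{a,b=1}^{4n}\mathbb S_{ab}x_ax_b$ and $\mathbf q'\in\mathbb H^n\cong\mathbb R^{4n}$. The hypersurface and the group $\mathcal N_{\mathbb S}$ are called right-type if $$\mathcal E:=\sum_{A,B=0}^{2n-1}(\nabla_A^{0'}\nabla_B^{1'}\phi)\,\omega^A\wedge\omega^B=0,$$ where $\omega^0,\dots,\omega^{2n-1}$ is a basis of $\mathbb C^{2n}$ and, for $l=0,\dots,n-1$, $\nabla_{2l}^{0'}=-\partial_{x_{4l+3}}-\mathbf i\partial_{x_{4l+4}}$, $\nabla_{2l}^{1'}=-\partial_{x_{4l+1}}-\mathbf i\partial_{x_{4l+2}}$, $\nabla_{2l+1}^{0'}=\partial_{x_{4l+1}}-\mathbf i\partial_{x_{4l+2}}$, $\nabla_{2l+1}^{1'}=-\partial_{x_{4l+3}}+\mathbf i\partial_{x_{4l+4}}$. *)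

theory Defs
  imports "HOL-Analysis.Analysis" "HOL-Algebra.Group"
begin

text \<open>
  The \<open>n\<close> quaternionic coordinates are indexed by a finite type \<open>'n\<close> (so \<open>n = CARD('n)\<close>), and
  \<open>\<real>\<^sup>4\<^sup>n\<close> is \<^typ>\<open>real ^ ('n \<times> 4)\<close>: the component \<open>x\<^bsub>4l+k\<^esub>\<close>, \<open>k = 1, \<dots>, 4\<close>, is \<open>x $ (l, k)\<close>.
  Likewise \<open>\<complex>\<^sup>2\<^sup>n\<close> is \<^typ>\<open>complex ^ ('n \<times> 2)\<close>, the index \<open>2l + j\<close>, \<open>j = 0, 1\<close>, being \<open>(l, j)\<close>.
  In the numeral types \<open>4 = 0\<close> in type \<open>4\<close> and \<open>3 = 0\<close> in type \<open>3\<close>; the indices \<open>1, \<dots>, 4\<close>,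
  respectively \<open>1, 2, 3\<close>, are pairwise distinct and exhaust the type.
\<close>

definition skew_unit :: "4 \<Rightarrow> 4 \<Rightarrow> real^4^4" where
  "skew_unit p q =
     (\<chi> i j. if i = p \<and> j = q then 1 else if i = q \<and> j = p then -1 else 0)"

definition I_mat :: "3 \<Rightarrow> real^4^4" where
  "I_mat \<beta> =
    (if \<beta> = 1 then skew_unit 1 2 - skew_unit 3 4
     else if \<beta> = 2 then skew_unit 1 3 + skew_unit 2 4
     else skew_unit 1 4 - skew_unit 2 3)"

definition J_mat :: "3 \<Rightarrow> real^4^4" where
  "J_mat \<beta> =
    (if \<beta> = 1 then skew_unit 1 2 + skew_unit 3 4
     else if \<beta> = 2 then skew_unit 1 3 - skew_unit 2 4
     else skew_unit 1 4 + skew_unit 2 3)"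

definition block_diag :: "real^4^4 \<Rightarrow> real^('n \<times> 4)^('n::finite \<times> 4)" where
  "block_diag M = (\<chi> a b. if fst a = fst b then M $ snd a $ snd b else 0)"

definition block :: "real^('n \<times> 4)^('n::finite \<times> 4) \<Rightarrow> 'n \<Rightarrow> 'n \<Rightarrow> real^4^4" where
  "block M l m = (\<chi> i j. M $ (l, i) $ (m, j))"

definition B_mat :: "real^('n \<times> 4)^('n::finite \<times> 4) \<Rightarrow> 3 \<Rightarrow> real^('n \<times> 4)^('n \<times> 4)" where
  "B_mat S \<beta> = S ** block_diag (I_mat \<beta>) + block_diag (I_mat \<beta>) ** S"

definition nil_group ::
  "real^('n \<times> 4)^('n::finite \<times> 4) \<Rightarrow> ((real^('n \<times> 4)) \<times> (real^3)) monoid" where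
  "nil_group S = \<lparr> carrier = UNIV,
     mult = (\<lambda>(x, t) (y, s).
       (x + y, \<chi> \<beta>. t $ \<beta> + s $ \<beta> + 2 * (\<Sum>a\<in>UNIV. \<Sum>b\<in>UNIV. B_mat S \<beta> $ a $ b * x $ a * y $ b))),
     one = (0, 0) \<rparr>"

definition quad_form :: "real^('n \<times> 4)^('n::finite \<times> 4) \<Rightarrow> real^('n \<times> 4) \<Rightarrow> real" where
  "quad_form S x = (\<Sum>a\<in>UNIV. \<Sum>b\<in>UNIV. S $ a $ b * x $ a * x $ b)"

definition partial_deriv ::
  "'n \<times> 4 \<Rightarrow> (real^('n::finite \<times> 4) \<Rightarrow> complex) \<Rightarrow> real^('n \<times> 4) \<Rightarrow> complex" where
  "partial_deriv a f x = vector_derivative (\<lambda>t. f (x + t *\<^sub>R axis a 1)) (at 0)"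

definition nabla0 ::
  "'n \<times> 2 \<Rightarrow> (real^('n::finite \<times> 4) \<Rightarrow> complex) \<Rightarrow> real^('n \<times> 4) \<Rightarrow> complex" where
  "nabla0 A f x = (let l = fst A in
     if snd A = 0 then - partial_deriv (l, 3) f x - \<i> * partial_deriv (l, 4) f x
     else partial_deriv (l, 1) f x - \<i> * partial_deriv (l, 2) f x)"

definition nabla1 ::
  "'n \<times> 2 \<Rightarrow> (real^('n::finite \<times> 4) \<Rightarrow> complex) \<Rightarrow> real^('n \<times> 4) \<Rightarrow> complex" where
  "nabla1 A f x = (let l = fst A in
     if snd A = 0 then - partial_deriv (l, 1) f x - \<i> * partial_deriv (l, 2) f x
     else - partial_deriv (l, 3) f x + \<i> * partial_deriv (l, 4) f x)"

text \<open>
  The exterior square of \<open>\<complex>\<^sup>m\<close> is realised as the antisymmetric tensors in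
  \<open>\<complex>\<^sup>m \<otimes> \<complex>\<^sup>m = complex ^ ('m \<times> 'm)\<close>, with \<open>u \<and> v = u \<otimes> v - v \<otimes> u\<close>.
\<close>

definition wedge :: "complex^'m \<Rightarrow> complex^'m \<Rightarrow> complex^('m::finite \<times> 'm)" where
  "wedge u v = (\<chi> p. u $ fst p * v $ snd p - v $ fst p * u $ snd p)"

definition is_basis :: "('m::finite \<Rightarrow> complex^'m) \<Rightarrow> bool" where
  "is_basis \<omega> \<longleftrightarrow> inj \<omega> \<and> vec.independent (range \<omega>) \<and> vec.span (range \<omega>) = UNIV"

definition E_form ::
  "('n \<times> 2 \<Rightarrow> complex^('n \<times> 2)) \<Rightarrow> (real^('n::finite \<times> 4) \<Rightarrow> real) \<Rightarrow> real^('n \<times> 4)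
     \<Rightarrow> complex^(('n \<times> 2) \<times> ('n \<times> 2))" where
  "E_form \<omega> \<phi> x =
     (\<Sum>A\<in>UNIV. \<Sum>B\<in>UNIV. nabla0 A (nabla1 B (\<lambda>y. of_real (\<phi> y))) x *s wedge (\<omega> A) (\<omega> B))"

text \<open>Right-type for the rigid hypersurface \<open>Re q\<^bsub>n+1\<^esub> = \<phi>(q')\<close> with defining function \<open>\<phi>\<close>.\<close>

definition right_type_hypersurface ::
  "('n \<times> 2 \<Rightarrow> complex^('n \<times> 2)) \<Rightarrow> (real^('n::finite \<times> 4) \<Rightarrow> real) \<Rightarrow> bool" where
  "right_type_hypersurface \<omega> \<phi> \<longleftrightarrow> (\<forall>x. E_form \<omega> \<phi> x = 0)"

text \<open>
  A group is right-type if it is the group of a quadratic hypersurface that is right-type. The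
  symmetric matrix is determined by the group, so the choice of \<open>S\<close> is immaterial; see
  \<open>nil_group_eq_iff\<close> and \<open>right_type_nil_group_iff\<close> below.
\<close>

definition right_type_group ::
  "('n \<times> 2 \<Rightarrow> complex^('n \<times> 2)) \<Rightarrow> ((real^('n::finite \<times> 4)) \<times> (real^3)) monoid \<Rightarrow> bool" where
  "right_type_group \<omega> G \<longleftrightarrow>
     (\<exists>S. transpose S = S \<and> G = nil_group S \<and> right_type_hypersurface \<omega> (quad_form S))"

lemma nil_group_eq_imp_B_mat_eq:
  assumes "nil_group S = nil_group T"
  shows "B_mat S \<beta> = B_mat T \<beta>"
proof -
  have dbl: "(\<Sum>a\<in>UNIV. \<Sum>b\<in>UNIV. M $ a $ b * axis c 1 $ a * axis d 1 $ b) = M $ c $ d"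
    for M :: "real^'m^'m" and c d :: 'm
    by (simp add: axis_def mult_delta_right cong: if_cong)
  have "B_mat S \<beta> $ c $ d = B_mat T \<beta> $ c $ d" for c d
  proof -
    have "mult (nil_group S) (axis c 1, 0) (axis d 1, 0) =
          mult (nil_group T) (axis c 1, 0) (axis d 1, 0)"
      using assms by simp
    then show ?thesis
      by (simp add: nil_group_def vec_eq_iff dbl)
  qed
  then show ?thesis by (simp add: vec_eq_iff)
qed

lemma block_B_mat:
  "block (B_mat S \<beta>) l m = I_mat \<beta> ** block S l m + block S l m ** I_mat \<beta>"
proof -
  have s1: "(\<Sum>k\<in>UNIV. g k * (if fst k = m then h (snd k) else 0)) = (\<Sum>j\<in>UNIV. g (m, j) * h j)"
    for g :: "'a \<times> 4 \<Rightarrow> real" and h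
  proof -
    have "(\<Sum>k\<in>UNIV. g k * (if fst k = m then h (snd k) else 0)) =
          (\<Sum>i\<in>UNIV. \<Sum>j\<in>UNIV. g (i, j) * (if i = m then h j else 0))"
      by (simp add: sum.cartesian_product case_prod_unfold flip: UNIV_Times_UNIV)
    also have "\<dots> = (\<Sum>i\<in>UNIV. if i = m then (\<Sum>j\<in>UNIV. g (i, j) * h j) else 0)"
      by (intro sum.cong refl) auto
    finally show ?thesis by simp
  qed
  have s2: "(\<Sum>k\<in>UNIV. (if l = fst k then h (snd k) else 0) * g k) = (\<Sum>j\<in>UNIV. h j * g (l, j))"
    for g :: "'a \<times> 4 \<Rightarrow> real" and h
  proof -
    have "(\<Sum>k\<in>UNIV. (if l = fst k then h (snd k) else 0) * g k) =
          (\<Sum>i\<in>UNIV. \<Sum>j\<in>UNIV. (if l = i then h j else 0) * g (i, j))"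
      by (simp add: sum.cartesian_product case_prod_unfold flip: UNIV_Times_UNIV)
    also have "\<dots> = (\<Sum>i\<in>UNIV. if l = i then (\<Sum>j\<in>UNIV. h j * g (i, j)) else 0)"
      by (intro sum.cong refl) auto
    finally show ?thesis by simp
  qed
  have "block (B_mat S \<beta>) l m $ i $ j = (I_mat \<beta> ** block S l m + block S l m ** I_mat \<beta>) $ i $ j"
    for i j
    using s1 [of "\<lambda>k. S $ (l, i) $ k" "\<lambda>k. I_mat \<beta> $ k $ j"]
      s2 [of "\<lambda>k. I_mat \<beta> $ i $ k" "\<lambda>k. S $ k $ (m, j)"]
    by (simp add: block_def B_mat_def block_diag_def matrix_matrix_mult_def cong: if_cong)
  then show ?thesis by (simp add: vec_eq_iff)
qed

lemma anticommute_I_mat_imp_zero: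
  fixes M :: "real^4^4"
  assumes "\<And>\<beta>. I_mat \<beta> ** M + M ** I_mat \<beta> = 0"
  shows "M = 0"
proof -
  have anti: "I_mat \<beta> ** M = - (M ** I_mat \<beta>)" for \<beta>
    using assms by (simp add: eq_neg_iff_add_eq_0)
  have I3: "I_mat 3 = I_mat 1 ** I_mat 2"
    by (simp add: vec_eq_iff forall_4 I_mat_def skew_unit_def matrix_matrix_mult_def sum_4)
  have neg: "A ** (- B) = - (A ** B)" "(- A) ** B = - (A ** B)" for A B :: "real^4^4"
    by (simp_all add: vec_eq_iff matrix_matrix_mult_def sum_negf)
  have "I_mat 3 ** M = M ** I_mat 3"
  proof -
    have "I_mat 3 ** M = I_mat 1 ** (I_mat 2 ** M)" by (simp add: I3 matrix_mul_assoc)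
    also have "\<dots> = - ((I_mat 1 ** M) ** I_mat 2)" by (simp add: anti [of 2] neg matrix_mul_assoc)
    also have "\<dots> = M ** I_mat 3" by (simp add: anti [of 1] neg I3 matrix_mul_assoc)
    finally show ?thesis .
  qed
  with anti [of 3] have "M ** I_mat 3 = 0"
    by (simp add: eq_neg_iff_add_eq_0 flip: scaleR_2)
  moreover have "I_mat 3 ** I_mat 3 = - mat 1"
    by (simp add: vec_eq_iff forall_4 I_mat_def skew_unit_def matrix_matrix_mult_def sum_4 mat_def)
  ultimately have "- M = 0 ** I_mat 3"
    using matrix_mul_assoc [of M "I_mat 3" "I_mat 3"] by (simp add: neg)
  then show ?thesis by simp
qed

lemma nil_group_eq_iff: "nil_group S = nil_group T \<longleftrightarrow> S = T"
proof
  assume eq: "nil_group S = nil_group T"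
  have "block S l m - block T l m = 0" for l m
  proof (rule anticommute_I_mat_imp_zero)
    fix \<beta>
    have "block (B_mat S \<beta>) l m = block (B_mat T \<beta>) l m"
      using nil_group_eq_imp_B_mat_eq[OF eq] by metis
    then show "I_mat \<beta> ** (block S l m - block T l m) + (block S l m - block T l m) ** I_mat \<beta> = 0"
      unfolding block_B_mat
      by (simp add: vec_eq_iff matrix_matrix_mult_def sum_subtractf algebra_simps)
  qed
  then show "S = T" by (simp add: block_def vec_eq_iff)
qed simp

lemma right_type_nil_group_iff:
  assumes "transpose S = S"
  shows "right_type_group \<omega> (nil_group S) \<longleftrightarrow> right_type_hypersurface \<omega> (quad_form S)"
  using assms by (auto simp: right_type_group_def nil_group_eq_iff)

end

theory Submission
  imports Defs
begin

text \<open>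
  For a quadratic \<open>\<phi>\<close> the coefficients \<open>h A B\<close> of \<open>\<E>\<close> are constant, and \<open>\<E> = 0\<close> means that \<open>h\<close> is
  symmetric. Since \<open>h (l, _) (m, _)\<close> only involves the block \<open>M = block S l m\<close>, this amounts to four real
  linear equations on each block: \<open>M\<close> is orthogonal to \<open>J\<^sup>1, J\<^sup>2, J\<^sup>3\<close> and the identity. On the other
  side, every \<open>4 \<times> 4\<close> matrix is \<open>M = M\<^sub>0 + \<Sum>\<^sub>\<gamma> I\<^sup>\<gamma> M\<^sub>\<gamma>\<close> with \<open>M\<^sub>0, M\<^sub>\<gamma>\<close> in the span of the \<open>J\<close>'s and the
  identity, which commutes with all \<open>I\<^sup>\<beta>\<close>; hence \<open>I\<^sup>\<beta> M + M I\<^sup>\<beta> = 2 I\<^sup>\<beta> M\<^sub>0 - 2 M\<^sub>\<beta>\<close> lies in that span iff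
  \<open>M\<^sub>0 = 0\<close>, which is the same orthogonality.
\<close>

lemma symmetric_matrix_nth:
  assumes "transpose S = S"
  shows "S $ a $ b = S $ b $ a"
proof -
  have "transpose S $ a $ b = S $ b $ a" by (simp add: transpose_def)
  with assms show ?thesis by simp
qed

text \<open>Independence is stated for the set \<open>range \<omega>\<close>; injectivity turns the
  indexed sum into a sum over that set.\<close>

lemma is_basis_sum_eq_0D:
  assumes "is_basis \<omega>" and "(\<Sum>A\<in>UNIV. c A *s \<omega> A) = 0"
  shows "c A = 0"
proof -
  have inj: "inj \<omega>" and ind: "vec.independent (range \<omega>)"
    using assms(1) by (auto simp: is_basis_def)
  have "(\<Sum>v\<in>range \<omega>. c (inv_into UNIV \<omega> v) *s v) = 0"
    using assms(2) inj by (simp add: sum.reindex)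
  then have "c (inv_into UNIV \<omega> (\<omega> A)) = 0"
    using vec.independentD[OF ind, of "range \<omega>" "\<lambda>v. c (inv_into UNIV \<omega> v)" "\<omega> A"] by simp
  then show ?thesis using inj by simp
qed

text \<open>Only the antisymmetric part of \<open>h\<close> survives against the wedge. Independence
  of \<open>\<omega>\<close> is then used once in each tensor factor.\<close>

lemma sum_wedge_eq_0_iff:
  assumes "is_basis \<omega>"
  shows "(\<Sum>A\<in>UNIV. \<Sum>B\<in>UNIV. h A B *s wedge (\<omega> A) (\<omega> B)) = 0 \<longleftrightarrow> (\<forall>A B. h A B = h B A)"
proof -
  have coord: "(\<Sum>A\<in>UNIV. \<Sum>B\<in>UNIV. h A B *s wedge (\<omega> A) (\<omega> B)) $ (p, q)
      = (\<Sum>A\<in>UNIV. (\<Sum>B\<in>UNIV. (h A B - h B A) * \<omega> B $ q) * \<omega> A $ p)" for p q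
  proof -
    have "(\<Sum>A\<in>UNIV. \<Sum>B\<in>UNIV. h A B *s wedge (\<omega> A) (\<omega> B)) $ (p, q)
      = (\<Sum>A\<in>UNIV. \<Sum>B\<in>UNIV. h A B * (\<omega> A $ p * \<omega> B $ q))
        - (\<Sum>A\<in>UNIV. \<Sum>B\<in>UNIV. h A B * (\<omega> B $ p * \<omega> A $ q))"
      by (simp add: wedge_def right_diff_distrib sum_subtractf)
    also have "(\<Sum>A\<in>UNIV. \<Sum>B\<in>UNIV. h A B * (\<omega> B $ p * \<omega> A $ q))
      = (\<Sum>A\<in>UNIV. \<Sum>B\<in>UNIV. h B A * (\<omega> A $ p * \<omega> B $ q))"
      by (rule sum.swap)
    also have "(\<Sum>A\<in>UNIV. \<Sum>B\<in>UNIV. h A B * (\<omega> A $ p * \<omega> B $ q))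
        - (\<Sum>A\<in>UNIV. \<Sum>B\<in>UNIV. h B A * (\<omega> A $ p * \<omega> B $ q))
      = (\<Sum>A\<in>UNIV. (\<Sum>B\<in>UNIV. (h A B - h B A) * \<omega> B $ q) * \<omega> A $ p)"
      by (simp add: sum_distrib_left sum_distrib_right right_diff_distrib mult_ac flip: sum_subtractf)
    finally show ?thesis .
  qed
  show ?thesis
  proof
    assume zero: "(\<Sum>A\<in>UNIV. \<Sum>B\<in>UNIV. h A B *s wedge (\<omega> A) (\<omega> B)) = 0"
    \<comment> \<open>With the second coordinate \<open>q\<close> fixed, this is a relation among
      the \<open>\<omega> A\<close>. Its coefficients, collected over \<open>q\<close>, form the
      next relation, among the \<open>\<omega> B\<close>.\<close>
    have "(\<Sum>A\<in>UNIV. (\<Sum>B\<in>UNIV. (h A B - h B A) * \<omega> B $ q) *s \<omega> A) = 0" for q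
      using coord[of _ q] zero by (simp add: vec_eq_iff)
    then have "(\<Sum>B\<in>UNIV. (h A B - h B A) * \<omega> B $ q) = 0" for A q
      by (rule is_basis_sum_eq_0D[OF assms])
    then have "(\<Sum>B\<in>UNIV. (h A B - h B A) *s \<omega> B) = 0" for A
      by (simp only: vec_eq_iff sum_component vector_smult_component zero_index simp_thms)
    then have "h A B - h B A = 0" for A B
      by (rule is_basis_sum_eq_0D[OF assms])
    then show "\<forall>A B. h A B = h B A" by simp
  next
    assume "\<forall>A B. h A B = h B A"
    then have diff: "h A B - h B A = 0" for A B
      by (metis right_minus_eq)
    show "(\<Sum>A\<in>UNIV. \<Sum>B\<in>UNIV. h A B *s wedge (\<omega> A) (\<omega> B)) = 0"
      by (simp only: vec_eq_iff split_paired_All coord diff mult_zero_left sum.neutral_const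
          zero_index simp_thms)
  qed
qed

lemma partial_deriv_linear:
  fixes f :: "real^('n::finite \<times> 4) \<Rightarrow> complex"
  assumes "linear f"
  shows "partial_deriv a f x = f (axis a 1)"
proof -
  have "((\<lambda>t. f x + t *\<^sub>R f (axis a 1)) has_vector_derivative f (axis a 1)) (at 0)"
    by (auto intro!: derivative_eq_intros)
  then show ?thesis
    unfolding partial_deriv_def
    by (simp add: linear_add[OF assms] linear_scale[OF assms] vector_derivative_at)
qed

lemma partial_deriv_quad_form:
  assumes "transpose S = S"
  shows "partial_deriv a (\<lambda>y. of_real (quad_form S y)) x = of_real (2 * (S *v x) $ a)"
proof -
  let ?e = "axis a 1 :: real^('a \<times> 4)"
  have quad: "quad_form S y = y \<bullet> (S *v y)" for y
    by (simp add: quad_form_def inner_vec_def matrix_vector_mult_def sum_distrib_left mult_ac)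
  have sym: "y \<bullet> (S *v z) = z \<bullet> (S *v y)" for y z
    by (metis assms dot_lmul_matrix inner_commute matrix_vector_mul_assoc transpose_matrix_vector)
  \<comment> \<open>The expansion in \<open>t\<close> is exact; at 0 only the linear coefficient
    contributes to the derivative.\<close>
  have expand: "quad_form S (x + t *\<^sub>R ?e) = quad_form S x + t * (2 * (S *v x) $ a) + t\<^sup>2 * quad_form S ?e"
    for t
    by (simp add: quad matrix_vector_right_distrib matrix_vector_mult_scaleR inner_add_left
        inner_add_right sym[of x ?e] inner_axis' power2_eq_square algebra_simps)
  have "((\<lambda>t. of_real (quad_form S x + t * (2 * (S *v x) $ a) + t\<^sup>2 * quad_form S ?e))
      has_vector_derivative complex_of_real (2 * (S *v x) $ a)) (at 0)"
    by (intro has_vector_derivative_of_real) (auto intro!: derivative_eq_intros)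
  then show ?thesis
    unfolding partial_deriv_def by (intro vector_derivative_at) (simp only: expand)
qed

text \<open>\<open>nabla1\<close> of a quadratic form is real-linear in the point, so
  \<open>nabla0\<close> merely evaluates it at axis vectors. The results are therefore independent
  of \<open>x\<close>.\<close>

lemma nabla0_nabla1_quad_form:
  fixes S :: "real^('n \<times> 4)^('n::finite \<times> 4)" and l m :: 'n
  assumes "transpose S = S"
  defines "D A B x \<equiv> nabla0 A (nabla1 B (\<lambda>y. of_real (quad_form S y))) x"
    and "M \<equiv> block S l m"
  shows "D (l, 0) (m, 0) x = 2 * Complex (M$3$1 - M$4$2) (M$3$2 + M$4$1)"
    and "D (l, 0) (m, 1) x = 2 * Complex (M$3$3 + M$4$4) (M$4$3 - M$3$4)"
    and "D (l, 1) (m, 0) x = - 2 * Complex (M$1$1 + M$2$2) (M$1$2 - M$2$1)"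
    and "D (l, 1) (m, 1) x = - 2 * Complex (M$1$3 - M$2$4) (- M$1$4 - M$2$3)"
proof -
  let ?G = "\<lambda>B. nabla1 B (\<lambda>y. of_real (quad_form S y))"
  have G0: "?G B = (\<lambda>x. (-1) * of_real (2 * (S *v x) $ (fst B, 1))
      + (-\<i>) * of_real (2 * (S *v x) $ (fst B, 2)))" if "snd B = 0" for B
    using that by (simp add: nabla1_def partial_deriv_quad_form[OF assms(1)] fun_eq_iff Let_def)
  have G1: "?G B = (\<lambda>x. (-1) * of_real (2 * (S *v x) $ (fst B, 3))
      + \<i> * of_real (2 * (S *v x) $ (fst B, 4)))" if "snd B \<noteq> 0" for B
    using that by (simp add: nabla1_def partial_deriv_quad_form[OF assms(1)] fun_eq_iff Let_def)
  have "linear (\<lambda>x. c * complex_of_real (2 * (S *v x) $ a))" for c a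
    by (rule linearI)
      (simp_all add: matrix_vector_right_distrib matrix_vector_mult_scaleR
        scaleR_conv_of_real[where 'a = complex] distrib_left mult.left_commute)
  then have lin: "linear (?G B)" for B
    by (cases "snd B = 0") (simp_all only: G0 G1 linear_compose_add simp_thms)
  have ax: "(S *v axis b 1) $ a = S $ a $ b" for a b
    by (simp add: matrix_vector_mult_basis column_def)
  \<comment> \<open>Differentiation yields entries of \<open>block S m l\<close>; symmetry carries
    them to \<open>block S l m\<close>.\<close>
  have sm: "S $ (m, i) $ (l, j) = S $ (l, j) $ (m, i)" for i j 
    by (rule symmetric_matrix_nth[OF assms(1)])
  have D0: "D (l, 0) B x = - ?G B (axis (l, 3) 1) - \<i> * ?G B (axis (l, 4) 1)" for B
    by (simp add: D_def nabla0_def partial_deriv_linear[OF lin])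
  have D1: "D (l, 1) B x = ?G B (axis (l, 1) 1) - \<i> * ?G B (axis (l, 2) 1)" for B
    by (simp add: D_def nabla0_def partial_deriv_linear[OF lin])
  show "D (l, 0) (m, 0) x = 2 * Complex (M$3$1 - M$4$2) (M$3$2 + M$4$1)"
    and "D (l, 0) (m, 1) x = 2 * Complex (M$3$3 + M$4$4) (M$4$3 - M$3$4)"
    and "D (l, 1) (m, 0) x = - 2 * Complex (M$1$1 + M$2$2) (M$1$2 - M$2$1)"
    and "D (l, 1) (m, 1) x = - 2 * Complex (M$1$3 - M$2$4) (- M$1$4 - M$2$3)"
    unfolding D0 D1
    by (simp_all add: G0 G1 ax sm complex_eq_iff M_def block_def)
qed

text \<open>The equations are the vanishing Frobenius products of \<open>M\<close> with
  \<open>mat 1\<close>, \<open>J_mat 1\<close>, \<open>J_mat 2\<close> and \<open>J_mat 3\<close>,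
  in this order.\<close>

definition J_orthogonal :: "real^4^4 \<Rightarrow> bool" where
  "J_orthogonal M \<longleftrightarrow> M$1$1 + M$2$2 + M$3$3 + M$4$4 = 0 \<and>
     M$1$2 - M$2$1 + M$3$4 - M$4$3 = 0 \<and>
     M$1$3 - M$3$1 - M$2$4 + M$4$2 = 0 \<and>
     M$1$4 - M$4$1 + M$2$3 - M$3$2 = 0"

text \<open>Adapts \<open>forall_2\<close>, which lists the indices 1 and 2, to the indices 0 and 1
  of the operators.\<close>

lemma forall_2_0: "(\<forall>i::2. P i) \<longleftrightarrow> P 0 \<and> P 1"
proof -
  have "(2::2) = 0" by simp
  then show ?thesis by (metis forall_2)
qed

lemma right_type_hypersurface_iff:
  assumes "transpose S = S" and "is_basis \<omega>"
  shows "right_type_hypersurface \<omega> (quad_form S) \<longleftrightarrow> (\<forall>l m. J_orthogonal (block S l m))"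
proof -
  have tr: "block S m l $ i $ j = block S l m $ j $ i" for m l i j
    by (simp add: block_def symmetric_matrix_nth[OF assms(1), of "(m, i)"])
  \<comment> \<open>The cases \<open>i = j\<close> give the \<open>J_mat 2\<close> and
    \<open>J_mat 3\<close> equations as real and imaginary parts; the cases
    \<open>i \<noteq> j\<close> give those of \<open>mat 1\<close> and
    \<open>J_mat 1\<close>.\<close>
  have pointwise: "(\<forall>i j. nabla0 (l, i) (nabla1 (m, j) (\<lambda>y. of_real (quad_form S y))) x
        = nabla0 (m, j) (nabla1 (l, i) (\<lambda>y. of_real (quad_form S y))) x) \<longleftrightarrow>
      J_orthogonal (block S l m)" for l m x
    unfolding forall_2_0 nabla0_nabla1_quad_form[OF assms(1)] J_orthogonal_def
    by (simp add: complex_eq_iff tr[of m l]) (intro iffI conjI; linarith)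
  have "right_type_hypersurface \<omega> (quad_form S) \<longleftrightarrow>
      (\<forall>x l m i j. nabla0 (l, i) (nabla1 (m, j) (\<lambda>y. of_real (quad_form S y))) x
        = nabla0 (m, j) (nabla1 (l, i) (\<lambda>y. of_real (quad_form S y))) x)"
    unfolding right_type_hypersurface_def E_form_def sum_wedge_eq_0_iff[OF assms(2)]
      split_paired_All by blast
  also have "\<dots> \<longleftrightarrow> (\<forall>l m. J_orthogonal (block S l m))"
    unfolding pointwise by simp
  finally show ?thesis .
qed

text \<open>A matrix in the span is determined by its first row, whose entries are its
  coefficients.\<close>

lemma in_span_J_iff:
  "X \<in> span {J_mat 1, J_mat 2, J_mat 3, mat 1} \<longleftrightarrow>
    X$2$2 = X$1$1 \<and> X$3$3 = X$1$1 \<and> X$4$4 = X$1$1 \<and>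
    X$2$1 = - X$1$2 \<and> X$3$4 = X$1$2 \<and> X$4$3 = - X$1$2 \<and>
    X$3$1 = - X$1$3 \<and> X$2$4 = - X$1$3 \<and> X$4$2 = X$1$3 \<and>
    X$4$1 = - X$1$4 \<and> X$2$3 = X$1$4 \<and> X$3$2 = - X$1$4" (is "_ \<longleftrightarrow> ?R X")
proof
  show "?R X" if "X \<in> span {J_mat 1, J_mat 2, J_mat 3, mat 1}"
    using that
    by (induction rule: span_induct_alt) (auto simp: J_mat_def skew_unit_def mat_def)
next
  assume "?R X"
  then have "X = X$1$2 *\<^sub>R J_mat 1 + X$1$3 *\<^sub>R J_mat 2 + X$1$4 *\<^sub>R J_mat 3 + X$1$1 *\<^sub>R mat 1"
    by (simp add: vec_eq_iff forall_4 J_mat_def skew_unit_def mat_def)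
  also have "\<dots> \<in> span {J_mat 1, J_mat 2, J_mat 3, mat 1}"
    by (intro span_add span_scale span_base) auto
  finally show "X \<in> span {J_mat 1, J_mat 2, J_mat 3, mat 1}" .
qed

text \<open>Entrywise, both sides become linear systems in the 16 entries of \<open>M\<close>, each
  implying the other.\<close>

lemma anticommutator_in_span_J_iff:
  "(\<forall>\<beta>. I_mat \<beta> ** M + M ** I_mat \<beta> \<in> span {J_mat 1, J_mat 2, J_mat 3, mat 1}) \<longleftrightarrow> J_orthogonal M"
  unfolding in_span_J_iff forall_3 J_orthogonal_def
  by (simp add: matrix_matrix_mult_def sum_4 I_mat_def skew_unit_def) (intro iffI conjI; linarith)

theorem proposition6p1:
  fixes S :: "real^('n \<times> 4)^('n::finite \<times> 4)"
    and \<omega> :: "'n \<times> 2 \<Rightarrow> complex^('n \<times> 2)"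
  assumes "transpose S = S"
    and "is_basis \<omega>"
  shows "right_type_group \<omega> (nil_group S) \<longleftrightarrow>
    (\<forall>l m \<beta>. block (B_mat S \<beta>) l m \<in> span {J_mat 1, J_mat 2, J_mat 3, mat 1})"
  unfolding right_type_nil_group_iff[OF assms(1)] right_type_hypersurface_iff[OF assms]
    block_B_mat anticommutator_in_span_J_iff ..

end
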